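(* Let $R$ be a strongly $\Delta$-clean ring. Then the factor ring $R/J(R)$ is reduced, i.e., it has no nonzero nilpotent elements.
   Context: Rings are associative with identity, not necessarily commutative. $U(R)$ is the group of units and $J(R)$ the Jacobson radical of $R$. Define $\Delta(R)=\{x\in R \mid 1-xu\in U(R)\text{ for all }u\in U(R)\}$. A ring $R$ is strongly $\Delta$-clean if every $a\in R$ can be written $a=e+d$ with $e^2=e\in R$, $d\in\Delta(R)$ and $ed=de$. *)

theory Defs
  imports "HOL-Algebra.Algebra"
begin

locale left_ideal = additive_subgroup I R + ring R for I and R (structure) +
  assumes left_closed: "\<lbrakk>a \<in> I; x \<in> carrier R\<rbrakk> \<Longrightarrow> x \<otimes> a \<in> I"

locale maximal_left_ideal = left_ideal +
  assumes proper: "I \<noteq> carrier R"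
    and maximal: "\<lbrakk>left_ideal L R; I \<subseteq> L\<rbrakk> \<Longrightarrow> L = I \<or> L = carrier R"

(* The ring need not be commutative, so maximal left ideals are used rather than the two-sided
   maximalideal of HOL-Algebra.  Intersecting with the carrier matters only for the zero ring,
   which has no maximal left ideal and is its own Jacobson radical. *)
definition jacobson_radical :: "('a, 'm) ring_scheme \<Rightarrow> 'a set" where
  "jacobson_radical R = carrier R \<inter> \<Inter>{M. maximal_left_ideal M R}"

definition Delta :: "('a, 'm) ring_scheme \<Rightarrow> 'a set" where
  "Delta R = {x \<in> carrier R. \<forall>u \<in> Units R. \<one>\<^bsub>R\<^esub> \<ominus>\<^bsub>R\<^esub> x \<otimes>\<^bsub>R\<^esub> u \<in> Units R}"

locale strongly_Delta_clean_ring = ring +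
  assumes strongly_Delta_clean:
    "a \<in> carrier R \<Longrightarrow>
      \<exists>e \<in> carrier R. \<exists>d \<in> Delta R. e \<otimes> e = e \<and> e \<otimes> d = d \<otimes> e \<and> a = e \<oplus> d"

definition nilpotent :: "('a, 'm) ring_scheme \<Rightarrow> 'a \<Rightarrow> bool" where
  "nilpotent R x \<longleftrightarrow> x \<in> carrier R \<and> (\<exists>n::nat. n > 0 \<and> x [^]\<^bsub>R\<^esub> n = \<zero>\<^bsub>R\<^esub>)"

locale reduced_ring = ring +
  assumes reduced: "nilpotent R x \<Longrightarrow> x = \<zero>"

end

theory Submission
  imports Defs
begin

text \<open>Strong \<open>\<Delta>\<close>-cleanness applied to a unit forces the idempotent to be \<open>1\<close>, so \<open>U(R) = 1 + \<Delta>(R)\<close>.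
  If \<open>x\<^sup>2 \<in> J(R)\<close> then \<open>1 - x\<close> is a unit, whence \<open>x \<in> \<Delta>(R)\<close>. Now let \<open>a\<^sup>2 \<in> J(R)\<close> and write
  \<open>r a = e + d\<close>. Since \<open>e r a = e (1 + d)\<close>, there is \<open>s = e s\<close> with \<open>s a = e\<close>. The element
  \<open>s (1 - e)\<close> has square zero, so it lies in \<open>\<Delta>(R)\<close>, and \<open>s (1 - e) a = e - s\<^sup>2 a\<^sup>2\<close>. As \<open>\<Delta>(R)\<close>
  is closed under sums and products and contains \<open>J(R)\<close>, it contains the idempotent \<open>e\<close>, so
  \<open>e = 0\<close> and \<open>1 - r a = 1 - d\<close> is a unit for every \<open>r\<close>, that is, \<open>a \<in> J(R)\<close>.\<close>

section \<open>Left ideals and the Jacobson radical\<close>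

context ring
begin

lemma left_idealI:
  assumes "I \<subseteq> carrier R" "\<zero> \<in> I"
    and "\<And>x y. x \<in> I \<Longrightarrow> y \<in> I \<Longrightarrow> x \<oplus> y \<in> I"
    and "\<And>r x. r \<in> carrier R \<Longrightarrow> x \<in> I \<Longrightarrow> r \<otimes> x \<in> I"
  shows "left_ideal I R"
proof -
  have "\<ominus> x \<in> I" if "x \<in> I" for x
  proof -
    have "\<ominus> x = (\<ominus> \<one>) \<otimes> x" using that assms(1) by (auto simp: l_minus)
    then show ?thesis using assms(4) that by simp
  qed
  then have "subgroup I (add_monoid R)"
    using assms by unfold_locales (auto simp: a_inv_def)
  then show ?thesis
    using assms(4) by (intro left_ideal.intro additive_subgroup.intro left_ideal_axioms.intro ring_axioms)
qed

lemma left_ideal_eq_carrier: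
  assumes "left_ideal I R" "\<one> \<in> I"
  shows "I = carrier R"
proof -
  interpret left_ideal I R by fact
  show ?thesis using left_closed[OF assms(2)] a_subset by fastforce
qed

text \<open>Two elements of the union lie in a common member of the chain, so closure under addition
  can be checked there. \<open>C\<close> must be nonempty for \<zero> to be in the union.\<close>

lemma left_ideal_Union_chain:
  assumes C: "C \<noteq> {}" "subset.chain {I. left_ideal I R} C"
  shows "left_ideal (\<Union>C) R"
proof (rule left_idealI)
  have li: "left_ideal I R" if "I \<in> C" for I
    using that C(2) by (auto simp: subset_chain_def)
  then have add: "additive_subgroup I R" if "I \<in> C" for I
    using that left_ideal.axioms(1) by blast
  show "\<Union>C \<subseteq> carrier R" using additive_subgroup.a_subset[OF add] by blast
  show "\<zero> \<in> \<Union>C" using C(1) additive_subgroup.zero_closed[OF add] by blast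
  show "x \<oplus> y \<in> \<Union>C" if "x \<in> \<Union>C" "y \<in> \<Union>C" for x y
  proof -
    obtain I where "I \<in> C" "x \<in> I" "y \<in> I"
      using \<open>x \<in> \<Union>C\<close> \<open>y \<in> \<Union>C\<close> C(2) unfolding subset_chain_def by blast
    then show ?thesis using additive_subgroup.a_closed[OF add] by blast
  qed
  show "r \<otimes> x \<in> \<Union>C" if "r \<in> carrier R" "x \<in> \<Union>C" for r x
    using that left_ideal.left_closed[OF li] by blast
qed

text \<open>Zorn's lemma on the left ideals that contain \<open>I\<close> and avoid \<one>. Avoiding
  \<one> is properness in a form that passes to unions of chains.\<close>

lemma exists_maximal_left_ideal:
  assumes I: "left_ideal I R" "\<one> \<notin> I"
  obtains M where "maximal_left_ideal M R" "I \<subseteq> M"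
proof -
  define P where "P = {L. left_ideal L R \<and> I \<subseteq> L \<and> \<one> \<notin> L}"
  have "\<exists>M\<in>P. \<forall>L\<in>P. M \<subseteq> L \<longrightarrow> L = M"
  proof (rule subset_Zorn_nonempty)
    show "P \<noteq> {}" using I P_def by blast
    fix C assume C: "C \<noteq> {}" "subset.chain P C"
    then have "subset.chain {I. left_ideal I R} C"
      by (auto simp: P_def subset_chain_def)
    then show "\<Union>C \<in> P"
      using C left_ideal_Union_chain[of C] by (auto simp: P_def subset_chain_def)
  qed
  then obtain M where M: "M \<in> P" and max: "\<And>L. L \<in> P \<Longrightarrow> M \<subseteq> L \<Longrightarrow> L = M" by blast
  have "maximal_left_ideal M R"
  proof (intro maximal_left_ideal.intro maximal_left_ideal_axioms.intro)
    show "left_ideal M R" "M \<noteq> carrier R" using M by (auto simp: P_def)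
    show "L = M \<or> L = carrier R" if "left_ideal L R" "M \<subseteq> L" for L
      using that M max[of L] left_ideal_eq_carrier[of L] by (auto simp: P_def)
  qed
  with M that show thesis by (auto simp: P_def)
qed

text \<open>This is I + Ra. For maximal \<open>I\<close> and \<open>a\<close> outside
  \<open>I\<close> it must be the whole ring; for zero \<open>I\<close> it is the principal left
  ideal of \<open>a\<close>.\<close>

lemma left_ideal_add_principal:
  assumes I: "left_ideal I R" and a: "a \<in> carrier R"
  shows "left_ideal {x \<oplus> r \<otimes> a |x r. x \<in> I \<and> r \<in> carrier R} R" (is "left_ideal ?L R")
proof (rule left_idealI)
  interpret I: left_ideal I R by fact
  show "?L \<subseteq> carrier R" using a by auto
  have "\<zero> = \<zero> \<oplus> \<zero> \<otimes> a" using a by simp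
  then show "\<zero> \<in> ?L" using I.zero_closed by blast
  show "x \<oplus> y \<in> ?L" if xy: "x \<in> ?L" "y \<in> ?L" for x y
  proof -
    obtain x' r y' s where *: "x' \<in> I" "r \<in> carrier R" "x = x' \<oplus> r \<otimes> a"
        "y' \<in> I" "s \<in> carrier R" "y = y' \<oplus> s \<otimes> a"
      using xy by blast
    then have "x' \<in> carrier R" "y' \<in> carrier R" by auto
    then have "x \<oplus> y = (x' \<oplus> y') \<oplus> (r \<oplus> s) \<otimes> a"
      using * a by (simp add: l_distr a_ac)
    then show ?thesis using * by blast
  qed
  show "t \<otimes> x \<in> ?L" if t: "t \<in> carrier R" and x: "x \<in> ?L" for t x
  proof -
    obtain x' r where *: "x' \<in> I" "r \<in> carrier R" "x = x' \<oplus> r \<otimes> a"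
      using x by blast
    then have "x' \<in> carrier R" by auto
    then have "t \<otimes> x = t \<otimes> x' \<oplus> (t \<otimes> r) \<otimes> a"
      using * a t by (simp add: r_distr m_assoc)
    then show ?thesis using * t I.left_closed by blast
  qed
qed

lemma left_ideal_zero: "left_ideal {\<zero>} R"
  by (rule left_idealI) auto

lemma left_ideal_principal:
  assumes a: "a \<in> carrier R"
  shows "left_ideal {r \<otimes> a |r. r \<in> carrier R} R"
proof -
  have "{r \<otimes> a |r. r \<in> carrier R} = {x \<oplus> r \<otimes> a |x r. x \<in> {\<zero>} \<and> r \<in> carrier R}"
    using a by force
  then show ?thesis using left_ideal_add_principal[OF left_ideal_zero a] by simp
qed

section \<open>The Jacobson radical through one-sided inverses\<close>

lemma jacobson_radical_closed: "a \<in> jacobson_radical R \<Longrightarrow> a \<in> carrier R"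
  by (simp add: jacobson_radical_def)

lemma left_ideal_jacobson_radical: "left_ideal (jacobson_radical R) R"
proof (rule left_idealI)
  have li: "left_ideal M R" if "maximal_left_ideal M R" for M
    using that maximal_left_ideal.axioms(1) by blast
  have add: "additive_subgroup M R" if "maximal_left_ideal M R" for M
    using li[OF that] left_ideal.axioms(1) by blast
  show "jacobson_radical R \<subseteq> carrier R" by (auto simp: jacobson_radical_def)
  show "\<zero> \<in> jacobson_radical R"
    using additive_subgroup.zero_closed[OF add] by (auto simp: jacobson_radical_def)
  show "x \<oplus> y \<in> jacobson_radical R" if "x \<in> jacobson_radical R" "y \<in> jacobson_radical R" for x y
    using that additive_subgroup.a_closed[OF add] by (auto simp: jacobson_radical_def)
  show "r \<otimes> x \<in> jacobson_radical R" if "r \<in> carrier R" "x \<in> jacobson_radical R" for r x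
    using that left_ideal.left_closed[OF li] by (auto simp: jacobson_radical_def)
qed

text \<open>Otherwise R(1 - a) is a proper left ideal, hence inside some maximal left ideal. That
  one also contains \<open>a\<close>, and so contains 1 = (1 - a) + a.\<close>

lemma jacobson_radical_left_inverse:
  assumes a: "a \<in> jacobson_radical R"
  obtains c where "c \<in> carrier R" "c \<otimes> (\<one> \<ominus> a) = \<one>"
proof (rule ccontr)
  assume "\<not> thesis"
  have ac: "a \<in> carrier R" using a by (rule jacobson_radical_closed)
  let ?I = "{r \<otimes> (\<one> \<ominus> a) |r. r \<in> carrier R}"
  have "left_ideal ?I R" using ac by (intro left_ideal_principal) simp
  moreover have "\<one> \<notin> ?I"
  proof
    assume "\<one> \<in> ?I"
    then obtain r where "r \<in> carrier R" "\<one> = r \<otimes> (\<one> \<ominus> a)" by blast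
    with that[of r] \<open>\<not> thesis\<close> show False by simp
  qed
  ultimately obtain M where M: "maximal_left_ideal M R" "?I \<subseteq> M"
    using exists_maximal_left_ideal by blast
  interpret maximal_left_ideal M R by fact
  have "\<one> \<otimes> (\<one> \<ominus> a) \<in> ?I" by blast
  then have "\<one> \<ominus> a \<in> M" using M(2) ac by auto
  moreover have "a \<in> M" using a M(1) by (auto simp: jacobson_radical_def)
  ultimately have "(\<one> \<ominus> a) \<oplus> a \<in> M" by blast
  moreover have "(\<one> \<ominus> a) \<oplus> a = \<one>" using ac by algebra
  ultimately show False
    using left_ideal_eq_carrier[OF maximal_left_ideal.axioms(1)[OF M(1)]] proper by simp
qed

lemma jacobson_radical_iff:
  "a \<in> jacobson_radical R \<longleftrightarrow>
     a \<in> carrier R \<and> (\<forall>r\<in>carrier R. \<exists>c\<in>carrier R. c \<otimes> (\<one> \<ominus> r \<otimes> a) = \<one>)" (is "_ \<longleftrightarrow> ?Q")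
proof
  interpret J: left_ideal "jacobson_radical R" R by (rule left_ideal_jacobson_radical)
  assume a: "a \<in> jacobson_radical R"
  then show ?Q
    using jacobson_radical_left_inverse[OF J.left_closed[OF a]] jacobson_radical_closed by metis
next
  assume Q: ?Q
  then have a: "a \<in> carrier R" by blast
  have "a \<in> M" if M: "maximal_left_ideal M R" for M
  proof (rule ccontr)
    assume "a \<notin> M"
    interpret maximal_left_ideal M R by fact
    have Mli: "left_ideal M R" using M maximal_left_ideal.axioms(1) by blast
    \<comment> \<open>Maximality turns M + Ra into R, so 1 = x + ra with x in \<open>M\<close>. Then
      x = 1 - ra has a left inverse by \<open>?Q\<close>, which puts 1 into
      \<open>M\<close>.\<close>
    let ?L = "{x \<oplus> r \<otimes> a |x r. x \<in> M \<and> r \<in> carrier R}"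
    have "M \<subseteq> ?L"
    proof
      fix x assume "x \<in> M"
      moreover from this have "x = x \<oplus> \<zero> \<otimes> a" using a by simp
      ultimately show "x \<in> ?L" by blast
    qed
    moreover have "a = \<zero> \<oplus> \<one> \<otimes> a" using a by simp
    then have "a \<in> ?L" using zero_closed by blast
    ultimately have "?L = carrier R"
      using maximal[OF left_ideal_add_principal[OF Mli a]] \<open>a \<notin> M\<close> by blast
    then have "\<one> \<in> ?L" by simp
    then obtain x r where xr: "x \<in> M" "r \<in> carrier R" "\<one> = x \<oplus> r \<otimes> a" by blast
    have "\<one> \<ominus> r \<otimes> a = x"
      unfolding xr(3) using xr(1,2) a by (simp add: a_minus_def a_assoc r_neg)
    then have "\<one> \<in> M" using Q xr(1,2) left_closed by metis
    then show False using left_ideal_eq_carrier[OF Mli] proper by simp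
  qed
  then show "a \<in> jacobson_radical R" using a by (simp add: jacobson_radical_def)
qed

text \<open>A left inverse c of 1 - a satisfies c = 1 + ca = 1 - (-c)a with (-c)a in the radical. So
  c has a left inverse d as well, and d = d(c(1 - a)) = 1 - a makes c two-sided.\<close>

lemma one_minus_jacobson_radical_Units:
  assumes a: "a \<in> jacobson_radical R"
  shows "\<one> \<ominus> a \<in> Units R"
proof -
  interpret J: left_ideal "jacobson_radical R" R by (rule left_ideal_jacobson_radical)
  have ac: "a \<in> carrier R" using a by (rule jacobson_radical_closed)
  obtain c where c: "c \<in> carrier R" "c \<otimes> (\<one> \<ominus> a) = \<one>"
    using jacobson_radical_left_inverse[OF a] by blast
  have "(\<ominus> c) \<otimes> a \<in> jacobson_radical R" using J.left_closed[OF a] c by simp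
  then obtain d where d: "d \<in> carrier R" "d \<otimes> (\<one> \<ominus> (\<ominus> c) \<otimes> a) = \<one>"
    using jacobson_radical_left_inverse by blast
  have "c = c \<otimes> (\<one> \<ominus> a) \<oplus> c \<otimes> a" using c(1) ac by algebra simp
  also have "\<dots> = \<one> \<ominus> (\<ominus> c) \<otimes> a" unfolding c(2) using c(1) ac by algebra
  finally have dc: "d \<otimes> c = \<one>" using d(2) by simp
  have "d = d \<otimes> (c \<otimes> (\<one> \<ominus> a))" using c d by simp
  also have "\<dots> = (d \<otimes> c) \<otimes> (\<one> \<ominus> a)" using c(1) d(1) ac by (simp add: m_assoc)
  also have "\<dots> = \<one> \<ominus> a" unfolding dc using ac by simp
  finally show ?thesis using c d dc ac unfolding Units_def by auto
qed

text \<open>If \<open>c\<close> is a left inverse of \<open>1 - b r a\<close>, then \<open>1 + r a c b\<close> is a left inverse of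
  \<open>1 - r a b\<close>; this makes the radical closed under right multiplication.\<close>

lemma ideal_jacobson_radical: "ideal (jacobson_radical R) R"
proof -
  interpret J: left_ideal "jacobson_radical R" R by (rule left_ideal_jacobson_radical)
  have "a \<otimes> b \<in> jacobson_radical R" if a: "a \<in> jacobson_radical R" and b: "b \<in> carrier R" for a b
    unfolding jacobson_radical_iff
  proof (intro conjI ballI)
    have ac: "a \<in> carrier R" using a by (rule jacobson_radical_closed)
    then show "a \<otimes> b \<in> carrier R" using b by simp
    fix r assume r: "r \<in> carrier R"
    obtain c where c: "c \<in> carrier R" "c \<otimes> (\<one> \<ominus> (b \<otimes> r) \<otimes> a) = \<one>"
      using a b r unfolding jacobson_radical_iff by (metis m_closed)
    have "(\<one> \<oplus> r \<otimes> a \<otimes> c \<otimes> b) \<otimes> (\<one> \<ominus> r \<otimes> (a \<otimes> b)) =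
        \<one> \<ominus> r \<otimes> a \<otimes> b \<oplus> r \<otimes> a \<otimes> (c \<otimes> (\<one> \<ominus> (b \<otimes> r) \<otimes> a)) \<otimes> b"
      using ac b c(1) r by algebra simp
    also have "\<dots> = \<one>" unfolding c(2) using ac b r by algebra
    finally show "\<exists>c\<in>carrier R. c \<otimes> (\<one> \<ominus> r \<otimes> (a \<otimes> b)) = \<one>"
      by (rule bexI) (use ac b c(1) r in simp)
  qed
  then show ?thesis
    using J.left_closed
    by (intro ideal.intro ideal_axioms.intro J.additive_subgroup_axioms ring_axioms) auto
qed

section \<open>The set \<open>\<Delta>(R)\<close>\<close>

lemma Units_minus:
  assumes u: "u \<in> Units R"
  shows "\<ominus> u \<in> Units R"
proof -
  from u have "(\<ominus> (inv u)) \<otimes> (\<ominus> u) = \<one>" "(\<ominus> u) \<otimes> (\<ominus> (inv u)) = \<one>"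
    by (simp_all add: l_minus r_minus Units_closed)
  moreover have "\<ominus> u \<in> carrier R" "\<ominus> (inv u) \<in> carrier R" using u by (simp_all add: Units_closed)
  ultimately show ?thesis unfolding Units_def by blast
qed

lemma Delta_closed: "x \<in> Delta R \<Longrightarrow> x \<in> carrier R"
  by (simp add: Delta_def)

lemma Delta_mult_Units:
  assumes "x \<in> Delta R" "u \<in> Units R"
  shows "x \<otimes> u \<in> Delta R"
  using assms by (auto simp: Delta_def m_assoc Units_closed)

lemma Delta_minus:
  assumes "x \<in> Delta R"
  shows "\<ominus> x \<in> Delta R"
  using Delta_mult_Units[OF assms Units_minus[OF Units_one_closed]] Delta_closed[OF assms]
  by (simp add: r_minus)

lemma one_minus_Delta_Units:
  assumes "x \<in> Delta R"
  shows "\<one> \<ominus> x \<in> Units R"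
proof -
  have "\<one> \<ominus> x \<otimes> \<one> \<in> Units R" using assms Units_one_closed unfolding Delta_def by blast
  then show ?thesis using Delta_closed[OF assms] by simp
qed

text \<open>Factor u - x as (1 - x \<open>inv u\<close>)u.\<close>

lemma Units_minus_Delta_Units:
  assumes x: "x \<in> Delta R" and u: "u \<in> Units R"
  shows "u \<ominus> x \<in> Units R"
proof -
  have xc: "x \<in> carrier R" using x by (rule Delta_closed)
  have "\<one> \<ominus> x \<otimes> inv u \<in> Units R" using x u by (auto simp: Delta_def)
  then have "(\<one> \<ominus> x \<otimes> inv u) \<otimes> u \<in> Units R" using u by simp
  moreover have "(\<one> \<ominus> x \<otimes> inv u) \<otimes> u = u \<ominus> x"
    using u xc by (simp add: a_minus_def l_distr l_minus m_assoc Units_closed)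
  ultimately show ?thesis by simp
qed

text \<open>Write 1 - (x + y)u as (1 - xu) - yu, a unit minus an element of
  \<open>Delta R\<close>.\<close>

lemma Delta_add:
  assumes x: "x \<in> Delta R" and y: "y \<in> Delta R"
  shows "x \<oplus> y \<in> Delta R"
  unfolding Delta_def
proof (intro CollectI conjI ballI)
  have c: "x \<in> carrier R" "y \<in> carrier R" using x y Delta_closed by auto
  then show "x \<oplus> y \<in> carrier R" by simp
  fix u assume u: "u \<in> Units R"
  have "(\<one> \<ominus> x \<otimes> u) \<ominus> y \<otimes> u \<in> Units R"
    using Units_minus_Delta_Units[OF Delta_mult_Units[OF y u]]
      one_minus_Delta_Units[OF Delta_mult_Units[OF x u]] by blast
  moreover have "(\<one> \<ominus> x \<otimes> u) \<ominus> y \<otimes> u = \<one> \<ominus> (x \<oplus> y) \<otimes> u"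
    using c Units_closed[OF u] by algebra
  ultimately show "\<one> \<ominus> (x \<oplus> y) \<otimes> u \<in> Units R" by simp
qed

text \<open>Since 1 - y is a unit, x(1 - y) is in \<open>Delta R\<close>, and xy = x - x(1 -
  y).\<close>

lemma Delta_mult:
  assumes x: "x \<in> Delta R" and y: "y \<in> Delta R"
  shows "x \<otimes> y \<in> Delta R"
proof -
  have c: "x \<in> carrier R" "y \<in> carrier R" using x y Delta_closed by auto
  have "x \<otimes> (\<one> \<ominus> y) \<in> Delta R" using Delta_mult_Units[OF x one_minus_Delta_Units[OF y]] .
  then have "x \<oplus> \<ominus> (x \<otimes> (\<one> \<ominus> y)) \<in> Delta R" by (intro Delta_add Delta_minus x)
  moreover have "x \<otimes> (\<one> \<ominus> y) = x \<ominus> x \<otimes> y" using c by (simp add: a_minus_def r_distr r_minus)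
  then have "x \<oplus> \<ominus> (x \<otimes> (\<one> \<ominus> y)) = x \<otimes> y" using c by algebra
  ultimately show ?thesis by simp
qed

lemma jacobson_radical_subset_Delta: "jacobson_radical R \<subseteq> Delta R"
proof
  interpret J: ideal "jacobson_radical R" R by (rule ideal_jacobson_radical)
  fix x assume "x \<in> jacobson_radical R"
  then show "x \<in> Delta R"
    using one_minus_jacobson_radical_Units J.I_r_closed by (auto simp: Delta_def)
qed

lemma idempotent_Delta_eq_zero:
  assumes "e \<in> Delta R" "e \<otimes> e = e"
  shows "e = \<zero>"
proof -
  have e: "e \<in> carrier R" using assms(1) by (rule Delta_closed)
  have u: "\<one> \<ominus> e \<in> Units R" using assms(1) by (rule one_minus_Delta_Units)
  have "(\<one> \<ominus> e) \<otimes> e = e \<ominus> e \<otimes> e" using e by algebra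
  also have "\<dots> = (\<one> \<ominus> e) \<otimes> \<zero>" using e assms(2) by simp
  finally show ?thesis using u e Units_l_cancel by blast
qed

lemma idempotent_Units_eq_one:
  assumes "e \<in> Units R" "e \<otimes> e = e"
  shows "e = \<one>"
  using assms by (metis Units_closed Units_l_cancel one_closed r_one)

text \<open>The commuting factors 1 - a and 1 + a have the unit 1 - aa as product, so 1 - a has a
  left and a right inverse, which then agree.\<close>

lemma one_minus_Units_of_square:
  assumes a: "a \<in> carrier R" and sq: "a \<otimes> a \<in> jacobson_radical R"
  shows "\<one> \<ominus> a \<in> Units R"
proof -
  let ?w = "\<one> \<ominus> a \<otimes> a"
  have w: "?w \<in> Units R" using sq by (rule one_minus_jacobson_radical_Units)
  have "(\<one> \<ominus> a) \<otimes> (\<one> \<oplus> a) = ?w" using a by algebra (simp add: r_neg1 r_neg2)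
  then have r: "(\<one> \<ominus> a) \<otimes> ((\<one> \<oplus> a) \<otimes> inv ?w) = \<one>"
    using w a by (simp flip: m_assoc)
  have "(\<one> \<oplus> a) \<otimes> (\<one> \<ominus> a) = ?w" using a by algebra (simp add: r_neg1 r_neg2)
  then have l: "(inv ?w \<otimes> (\<one> \<oplus> a)) \<otimes> (\<one> \<ominus> a) = \<one>"
    using w a by (simp add: m_assoc)
  have eq: "inv ?w \<otimes> (\<one> \<oplus> a) = (\<one> \<oplus> a) \<otimes> inv ?w"
    using inv_unique[OF l r] w a by simp
  have "inv ?w \<otimes> (\<one> \<oplus> a) \<in> carrier R" "\<one> \<ominus> a \<in> carrier R" using w a by simp_all
  then show ?thesis using l r[folded eq] unfolding Units_def by blast
qed

end

section \<open>Strongly \<open>\<Delta>\<close>-clean rings\<close>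

context strongly_Delta_clean_ring
begin

text \<open>Decompose 1 - a = e + d. Then e = (1 - a) - d is an idempotent unit, so e = 1 and a =
  -d.\<close>

lemma one_minus_Units_imp_Delta:
  assumes a: "a \<in> carrier R" and u: "\<one> \<ominus> a \<in> Units R"
  shows "a \<in> Delta R"
proof -
  obtain e d where ed: "e \<in> carrier R" "d \<in> Delta R" "e \<otimes> e = e" "\<one> \<ominus> a = e \<oplus> d"
    using strongly_Delta_clean[of "\<one> \<ominus> a"] a by auto
  have d: "d \<in> carrier R" using ed(2) by (rule Delta_closed)
  have "e = (e \<oplus> d) \<ominus> d" using ed(1) d by algebra
  then have "e \<in> Units R" using Units_minus_Delta_Units[OF ed(2) u] ed(4) by simp
  then have e1: "e = \<one>" using ed(3) by (rule idempotent_Units_eq_one)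
  have "a = \<one> \<ominus> (\<one> \<ominus> a)" using a by algebra
  also have "\<dots> = \<ominus> d" unfolding ed(4) e1 using d by algebra
  finally show ?thesis using Delta_minus[OF ed(2)] by simp
qed

lemma square_jacobson_radical:
  assumes a: "a \<in> carrier R" and sq: "a \<otimes> a \<in> jacobson_radical R"
  shows "a \<in> jacobson_radical R"
  unfolding jacobson_radical_iff
proof (intro conjI ballI a)
  interpret J: ideal "jacobson_radical R" R by (rule ideal_jacobson_radical)
  have sqD: "x \<in> Delta R" if "x \<in> carrier R" "x \<otimes> x \<in> jacobson_radical R" for x
    using that one_minus_Units_of_square one_minus_Units_imp_Delta by blast
  fix r assume r: "r \<in> carrier R"
  obtain e d where ed: "e \<in> carrier R" "d \<in> Delta R" "e \<otimes> e = e" "e \<otimes> d = d \<otimes> e" "r \<otimes> a = e \<oplus> d"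
    using strongly_Delta_clean[of "r \<otimes> a"] a r by auto
  have d: "d \<in> carrier R" using ed(2) by (rule Delta_closed)
  \<comment> \<open>This is 1 + d, written so that \<open>one_minus_Delta_Units\<close> applies to
    -d.\<close>
  define w where "w = \<one> \<ominus> \<ominus> d"
  have w: "w \<in> Units R" using ed(2) unfolding w_def by (intro one_minus_Delta_Units Delta_minus)
  then have wc: "w \<in> carrier R" by (rule Units_closed)
  have ewd: "e \<otimes> w = w \<otimes> e"
    unfolding w_def using ed(1,4) d by (simp add: a_minus_def r_distr l_distr)
  have ew: "inv w \<otimes> e = e \<otimes> inv w"
  proof -
    have "inv w \<otimes> e = inv w \<otimes> (e \<otimes> w) \<otimes> inv w"
      using ed(1) w wc by (simp add: m_assoc)
    also have "\<dots> = e \<otimes> inv w"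
      unfolding ewd using ed(1) w wc by (simp flip: m_assoc)
    finally show ?thesis .
  qed
  \<comment> \<open>Chosen to solve sa = e: from e(ra) = e(e + d) = ew and the commutation of e with
    w and \<open>inv w\<close>, sa = \<open>inv w\<close>(ew) = e.\<close>
  define s where "s = e \<otimes> inv w \<otimes> r"
  have s: "s \<in> carrier R" using ed(1) w r by (simp add: s_def)
  have es: "e \<otimes> s = s"
    using ed(1,3) w r by (simp add: s_def flip: m_assoc)
  have "e \<otimes> (r \<otimes> a) = e \<otimes> w"
    unfolding ed(5) w_def using ed(1,3) d by (simp add: a_minus_def r_distr)
  then have sa: "s \<otimes> a = e"
    unfolding s_def ew[symmetric] using ed(1) w wc r a
    by (simp add: m_assoc ewd) (simp flip: m_assoc)
  \<comment> \<open>As es = s, the middle factor (1 - e)s of \<open>?t\<close> squared vanishes, so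
    \<open>sqD\<close> covers \<open>?t\<close> as well as \<open>a\<close>.\<close>
  let ?t = "s \<otimes> (\<one> \<ominus> e)"
  have "(\<one> \<ominus> e) \<otimes> s = \<zero>"
    using es s ed(1) by (simp add: a_minus_def l_distr l_minus r_neg)
  then have "?t \<otimes> ?t = s \<otimes> \<zero> \<otimes> (\<one> \<ominus> e)"
    using s ed(1) by (metis m_assoc m_closed minus_closed one_closed)
  then have "?t \<otimes> ?t \<in> jacobson_radical R" using s ed(1) by simp
  then have "?t \<in> Delta R" using s ed(1) by (intro sqD) auto
  then have ta: "?t \<otimes> a \<in> Delta R" using sqD[OF a sq] by (rule Delta_mult)
  \<comment> \<open>Substituting e = sa gives \<open>?t\<close> a = sa - ssaa; adding the radical
    element ssaa recovers sa = e.\<close>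
  have "s \<otimes> s \<otimes> (a \<otimes> a) \<in> jacobson_radical R" using J.I_l_closed[OF sq] s by simp
  then have "?t \<otimes> a \<oplus> s \<otimes> s \<otimes> (a \<otimes> a) \<in> Delta R"
    using ta jacobson_radical_subset_Delta by (intro Delta_add) auto
  moreover have "?t \<otimes> a \<oplus> s \<otimes> s \<otimes> (a \<otimes> a) = s \<otimes> a"
    unfolding sa[symmetric] using s a by algebra
  ultimately have "e \<in> Delta R" using sa by simp
  then have "e = \<zero>" using ed(3) by (rule idempotent_Delta_eq_zero)
  then have "\<one> \<ominus> r \<otimes> a \<in> Units R" using ed(2,5) d one_minus_Delta_Units by simp
  then show "\<exists>c\<in>carrier R. c \<otimes> (\<one> \<ominus> r \<otimes> a) = \<one>"
    using Units_l_inv_ex by blast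
qed

text \<open>Multiplying the power n + 2 by the power n gives the square of the power n + 1, so
  \<open>square_jacobson_radical\<close> lowers the exponent by one. \<open>Suc n\<close> excludes
  exponent 0, where the power is 1.\<close>

lemma nat_pow_jacobson_radical:
  assumes a: "a \<in> carrier R"
  shows "a [^] Suc n \<in> jacobson_radical R \<Longrightarrow> a \<in> jacobson_radical R"
proof (induction n)
  case 0
  then show ?case using a by simp
next
  case (Suc n)
  interpret J: ideal "jacobson_radical R" R by (rule ideal_jacobson_radical)
  have "a [^] n \<otimes> a [^] Suc (Suc n) \<in> jacobson_radical R"
    using Suc.prems a J.I_l_closed by blast
  moreover have "a [^] n \<otimes> a [^] Suc (Suc n) = a [^] Suc n \<otimes> a [^] Suc n"
    by (simp only: nat_pow_mult[OF a]) simp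
  ultimately show ?case
    using square_jacobson_radical[of "a [^] Suc n"] Suc.IH a by simp
qed

end

theorem lemma2p15:
  fixes R :: "('a, 'm) ring_scheme"
  assumes "strongly_Delta_clean_ring R"
  shows "reduced_ring (R Quot jacobson_radical R)"
proof -
  interpret strongly_Delta_clean_ring R by fact
  let ?J = "jacobson_radical R"
  interpret J: ideal ?J R by (rule ideal_jacobson_radical)
  \<comment> \<open>The zero of the quotient is the coset \<open>?J\<close> itself, so nilpotency of
    x reads as a power of x being \<open>?J\<close>.\<close>
  have zero: "\<zero>\<^bsub>R Quot ?J\<^esub> = ?J" by (simp add: FactRing_def)
  show ?thesis
  proof (intro reduced_ring.intro reduced_ring_axioms.intro J.quotient_is_ring)
    fix x assume "nilpotent (R Quot ?J) x"
    then obtain n where x: "x \<in> carrier (R Quot ?J)"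
      and n: "0 < n" "x [^]\<^bsub>R Quot ?J\<^esub> (n::nat) = ?J"
      unfolding nilpotent_def zero by blast
    obtain a where a: "a \<in> carrier R" "x = ?J +>\<^bsub>R\<^esub> a"
      using x by (auto simp: FactRing_def A_RCOSETS_def')
    obtain m where m: "n = Suc m" using n(1) by (cases n) auto
    \<comment> \<open>The projection is a ring homomorphism, so the power of the coset is the coset
      of the power; containing its own representative, it places that power of \<open>a\<close> in
      \<open>?J\<close>.\<close>
    have "?J +>\<^bsub>R\<^esub> a [^]\<^bsub>R\<^esub> n = ?J" 
      using n(2) a ring_hom_ring.hom_nat_pow[OF J.rcos_ring_hom_ring] by metis
    moreover have "a [^]\<^bsub>R\<^esub> n \<in> ?J +>\<^bsub>R\<^esub> a [^]\<^bsub>R\<^esub> n" using a(1) by (intro J.a_rcos_self) simp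
    ultimately have "a [^]\<^bsub>R\<^esub> Suc m \<in> ?J" using m by simp
    then have "a \<in> ?J" by (rule nat_pow_jacobson_radical[OF a(1)])
    then show "x = \<zero>\<^bsub>R Quot ?J\<^esub>" unfolding a(2) zero by (rule J.a_rcos_const)
  qed
qed

end
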